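(* Let $(K,\partial)$ be a complex and let $X=(P,S,C)$ be a perfect HDVF for $(K,\partial)$ with associated reduction $(f,g,h)$. Then, for every $q$, the associated $q$-homology basis $\big(g_q(\gamma)\big)_{\gamma\in C_q}$ is an explicit $q$-homology basis of $(K,\partial)$.
   Context: Coefficients are in $\mathcal F=\mathbb{Z}/2\mathbb{Z}$. A complex $(K,\partial)$ is the chain complex of a finite cellular complex of dimension $n$: for $0\le q\le n$, $K_q$ is the $\mathcal F$-vector space with basis the finite set $\overline{K_q}$ of $q$-cells, and $\partial_q:K_q\to K_{q-1}$ is the cellular boundary map, with $\partial_q\partial_{q+1}=0$ and $\partial_0=0$. Write $K=\bigoplus_q K_q$, $\partial=\bigoplus_q\partial_q$, and $\overline K=\bigcup_q\overline{K_q}$ for the set of all cells. $H_q(K)=\ker\partial_q/\operatorname{im}\partial_{q+1}$. For a set of cells $A$, $\mathtt i_A:\operatorname{Span}A\to K$ is the inclusion, $\mathtt j_A:K\to\operatorname{Span}A$ the coordinate projection, $A_q$ the set of $q$-cells in $A$, and $\partial_{AB}=\mathtt j_B\circ\partial\circ\mathtt i_A$. HDVF: a homological discrete vector field (HDVF) for $(K,\partial)$ is a triple $X=(P,S,C)$ forming a partition of $\overline K$ (parts may be empty) such that $\partial_{SP}:\operatorname{Span}S\to\operatorname{Span}P$ is invertible. Put $H=(\partial_{SP})^{-1}$, $F=-\partial_{SC}H$, $G=-H\partial_{CP}$. Its associated reduction $(f,g,h)$ consists of $g=\mathtt i_C+\mathtt i_S G:\operatorname{Span}C\to K$, $f=F\,\mathtt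 j_P+\mathtt j_C:K\to\operatorname{Span}C$, $h=\mathtt i_S H\,\mathtt j_P:K\to K$ (of degree $+1$), with reduced boundary $d=\partial_{CC}-\partial_{SC}H\partial_{CP}$. The HDVF is perfect if $d=0$; in that case $(g_q(\gamma))_{\gamma\in C_q}$ is a $q$-homology basis, where $g_q$ is the restriction of $g$ to $\operatorname{Span}C_q$. A $q$-homology basis of $(K,\partial)$ is a family $(\mathtt g_i)_{i\le\beta}$ of $q$-cycles (elements of $\ker\partial_q$) whose classes form a basis of $H_q(K)$. Explicit bases: for a chain $x$, $\overline x$ is the set of cells with nonzero coefficient in $x$. For a set of cells $A$, $(K(A),\partial)$ is the smallest sub-complex (spanned by cells) containing $A$; it is spanned by the cells of $A$ and all their faces. For a $q$-homology basis $(\mathtt g_i)_{i\le\beta}$, put $K^\beta=K\big(\bigcup_{i\le\beta}\overline{\mathtt g_i}\big)$. The basis is explicit if for all $k$, $\overline{\mathtt g_k}\setminus\bigcup_{i\ne k}\overline{\mathtt g_i}\neq\emptyset$, and $\dim H_q(K^\beta)=\beta$. *)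

theory Defs
  imports
    "HOL-Library.Poly_Mapping"
    "HOL-Library.Z2"
    "HOL-Algebra.AbelCoset"
    "Jordan_Normal_Form.VS_Connect"
begin

text \<open>These simp rules would rewrite the field operations on bits into bitwise ones.\<close>

declare add_bit_eq_xor [simp del] mult_bit_eq_and [simp del]

section \<open>Chains over the field with two elements\<close>

type_synonym 'a chain = "'a \<Rightarrow>\<^sub>0 bit"

text \<open>The vector space spanned by a set \<open>A\<close> of cells. The ring multiplication and unit of the
  module record are not used by a vector space.\<close>

definition chain_space :: "'a set \<Rightarrow> (bit, 'a chain) module" where
  "chain_space A = \<lparr>carrier = {x. Poly_Mapping.keys x \<subseteq> A}, mult = undefined, one = undefined,
     zero = 0, add = (+), smult = (\<lambda>c. Poly_Mapping.map ((*) c))\<rparr>"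

abbreviation chains :: "'a set \<Rightarrow> 'a chain set" where
  "chains A \<equiv> carrier (chain_space A)"

abbreviation cell_chain :: "'a \<Rightarrow> 'a chain" where
  "cell_chain \<sigma> \<equiv> Poly_Mapping.single \<sigma> 1"

definition proj :: "'a set \<Rightarrow> 'a chain \<Rightarrow> 'a chain" where
  "proj A = Poly_Mapping.mapp (\<lambda>\<sigma> c. c when \<sigma> \<in> A)"

text \<open>The quotient of a vector space \<open>V\<close> by a subspace \<open>N\<close>; its vectors are the cosets of \<open>N\<close>.\<close>

definition quotient_space :: "('k, 'v, 'm) module_scheme \<Rightarrow> 'v set \<Rightarrow> ('k, 'v set) module" where
  "quotient_space V N = \<lparr>carrier = a_rcosets\<^bsub>V\<^esub> N, mult = undefined, one = undefined,
     zero = N, add = (\<lambda>X Y. X <+>\<^bsub>V\<^esub> Y), smult = (\<lambda>c X. \<Union>x\<in>X. N +>\<^bsub>V\<^esub> (c \<odot>\<^bsub>V\<^esub> x))\<rparr>"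


section \<open>Complexes and their homology\<close>

text \<open>Only the chain complex with its distinguished basis of cells is recorded. The maps
  \<open>\<partial>\<^sub>q\<close> are the restrictions of \<open>bd\<close> to \<open>chains (cells K q)\<close>; the values of \<open>bd\<close> outside
  \<open>chains (all_cells K)\<close> are irrelevant.\<close>

record 'a complex_data =
  cells :: "nat \<Rightarrow> 'a set"
  bd :: "'a chain \<Rightarrow> 'a chain"

definition all_cells :: "'a complex_data \<Rightarrow> 'a set" where
  "all_cells K = (\<Union>q. cells K q)"

locale cell_complex =
  fixes n :: nat and K :: "'a complex_data"
  assumes finite_cells: "\<And>q. finite (cells K q)"
    and disjoint_cells: "\<And>p q. p \<noteq> q \<Longrightarrow> cells K p \<inter> cells K q = {}"
    and cells_above: "\<And>q. n < q \<Longrightarrow> cells K q = {}"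
    and bd_linear: "linear_map class_ring (chain_space (all_cells K)) (chain_space (all_cells K)) (bd K)"
    and bd_degree: "\<And>q x. x \<in> chains (cells K (Suc q)) \<Longrightarrow> bd K x \<in> chains (cells K q)"
    and bd_0: "\<And>x. x \<in> chains (cells K 0) \<Longrightarrow> bd K x = 0"
    and bd_bd: "\<And>x. x \<in> chains (all_cells K) \<Longrightarrow> bd K (bd K x) = 0"

definition cycles :: "'a complex_data \<Rightarrow> nat \<Rightarrow> 'a chain set" where
  "cycles K q = {x \<in> chains (cells K q). bd K x = 0}"

definition boundaries :: "'a complex_data \<Rightarrow> nat \<Rightarrow> 'a chain set" where
  "boundaries K q = bd K ` chains (cells K (Suc q))"

definition cycle_space :: "'a complex_data \<Rightarrow> nat \<Rightarrow> (bit, 'a chain) module" where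
  "cycle_space K q = (chain_space (cells K q))\<lparr>carrier := cycles K q\<rparr>"

definition homology :: "'a complex_data \<Rightarrow> nat \<Rightarrow> (bit, 'a chain set) module" where
  "homology K q = quotient_space (cycle_space K q) (boundaries K q)"

definition homology_class :: "'a complex_data \<Rightarrow> nat \<Rightarrow> 'a chain \<Rightarrow> 'a chain set" where
  "homology_class K q z = boundaries K q +>\<^bsub>cycle_space K q\<^esub> z"


section \<open>Sub-complexes\<close>

text \<open>A set of cells spans a sub-complex when the span is stable under the boundary.\<close>

definition is_subcomplex :: "'a complex_data \<Rightarrow> 'a set \<Rightarrow> bool" where
  "is_subcomplex K B \<longleftrightarrow> B \<subseteq> all_cells K \<and> bd K ` chains B \<subseteq> chains B"

definition closure_cells :: "'a complex_data \<Rightarrow> 'a set \<Rightarrow> 'a set" where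
  "closure_cells K A = \<Inter>{B. A \<subseteq> B \<and> is_subcomplex K B}"

definition generated_subcomplex :: "'a complex_data \<Rightarrow> 'a set \<Rightarrow> 'a complex_data" where
  "generated_subcomplex K A = K\<lparr>cells := (\<lambda>q. cells K q \<inter> closure_cells K A)\<rparr>"


section \<open>Homology bases\<close>

text \<open>A family is a basis when it is injective and its set of members is a basis.\<close>

definition homology_basis ::
    "'a complex_data \<Rightarrow> nat \<Rightarrow> 'i set \<Rightarrow> ('i \<Rightarrow> 'a chain) \<Rightarrow> bool" where
  "homology_basis K q I z \<longleftrightarrow>
     finite I \<and> z ` I \<subseteq> cycles K q \<and>
     inj_on (\<lambda>i. homology_class K q (z i)) I \<and>
     vectorspace.basis class_ring (homology K q) ((\<lambda>i. homology_class K q (z i)) ` I)"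

definition explicit_homology_basis ::
    "'a complex_data \<Rightarrow> nat \<Rightarrow> 'i set \<Rightarrow> ('i \<Rightarrow> 'a chain) \<Rightarrow> bool" where
  "explicit_homology_basis K q I z \<longleftrightarrow>
     homology_basis K q I z \<and>
     (\<forall>k\<in>I. Poly_Mapping.keys (z k) - (\<Union>i\<in>I - {k}. Poly_Mapping.keys (z i)) \<noteq> {}) \<and>
     vectorspace.dim class_ring
       (homology (generated_subcomplex K (\<Union>i\<in>I. Poly_Mapping.keys (z i))) q) = card I"


section \<open>Homological discrete vector fields\<close>

definition bd_part :: "'a complex_data \<Rightarrow> 'a set \<Rightarrow> 'a set \<Rightarrow> 'a chain \<Rightarrow> 'a chain" where
  "bd_part K A B = (\<lambda>x\<in>chains A. proj B (bd K x))"

definition hdvf :: "'a complex_data \<Rightarrow> 'a set \<Rightarrow> 'a set \<Rightarrow> 'a set \<Rightarrow> bool" where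
  "hdvf K P S C \<longleftrightarrow>
     P \<union> S \<union> C = all_cells K \<and> P \<inter> S = {} \<and> P \<inter> C = {} \<and> S \<inter> C = {} \<and>
     bij_betw (bd_part K S P) (chains S) (chains P)"

definition hdvf_H :: "'a complex_data \<Rightarrow> 'a set \<Rightarrow> 'a set \<Rightarrow> 'a chain \<Rightarrow> 'a chain" where
  "hdvf_H K P S = (\<lambda>y\<in>chains P. the_inv_into (chains S) (bd_part K S P) y)"

definition hdvf_F :: "'a complex_data \<Rightarrow> 'a set \<Rightarrow> 'a set \<Rightarrow> 'a set \<Rightarrow> 'a chain \<Rightarrow> 'a chain" where
  "hdvf_F K P S C = (\<lambda>y\<in>chains P. - bd_part K S C (hdvf_H K P S y))"

definition hdvf_G :: "'a complex_data \<Rightarrow> 'a set \<Rightarrow> 'a set \<Rightarrow> 'a set \<Rightarrow> 'a chain \<Rightarrow> 'a chain" where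
  "hdvf_G K P S C = (\<lambda>x\<in>chains C. - hdvf_H K P S (bd_part K C P x))"

text \<open>The inclusions \<open>i\<^sub>C\<close> and \<open>i\<^sub>S\<close> are implicit, since a chain on a subset of the cells is a
  chain of \<open>K\<close>.\<close>

definition hdvf_reduction :: "'a complex_data \<Rightarrow> 'a set \<Rightarrow> 'a set \<Rightarrow> 'a set \<Rightarrow>
    ('a chain \<Rightarrow> 'a chain) \<times> ('a chain \<Rightarrow> 'a chain) \<times> ('a chain \<Rightarrow> 'a chain)" where
  "hdvf_reduction K P S C =
     (\<lambda>x\<in>chains (all_cells K). hdvf_F K P S C (proj P x) + proj C x,
      \<lambda>x\<in>chains C. x + hdvf_G K P S C x,
      \<lambda>x\<in>chains (all_cells K). hdvf_H K P S (proj P x))"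

definition reduced_bd :: "'a complex_data \<Rightarrow> 'a set \<Rightarrow> 'a set \<Rightarrow> 'a set \<Rightarrow> 'a chain \<Rightarrow> 'a chain" where
  "reduced_bd K P S C =
     (\<lambda>x\<in>chains C. bd_part K C C x - bd_part K S C (hdvf_H K P S (bd_part K C P x)))"

definition perfect_hdvf :: "'a complex_data \<Rightarrow> 'a set \<Rightarrow> 'a set \<Rightarrow> 'a set \<Rightarrow> bool" where
  "perfect_hdvf K P S C \<longleftrightarrow>
     hdvf K P S C \<and> (\<forall>x\<in>chains C. reduced_bd K P S C x = 0)"


section \<open>Well-formedness of the vector spaces and sub-complexes\<close>

lemma lookup_scale [simp]:
  "Poly_Mapping.lookup (Poly_Mapping.map ((*) (c::bit)) x) \<sigma> = c * Poly_Mapping.lookup x \<sigma>"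
  by (simp add: map.rep_eq when_def)

lemma lookup_proj:
  "Poly_Mapping.lookup (proj A x) \<sigma> = (Poly_Mapping.lookup x \<sigma> when \<sigma> \<in> A)"
  by (auto simp: proj_def lookup_mapp when_def in_keys_iff)

lemma chain_space_simps [simp]:
  "carrier (chain_space A) = {x. Poly_Mapping.keys x \<subseteq> A}"
  "zero (chain_space A) = 0" "add (chain_space A) = (+)"
  "module.smult (chain_space A) = (\<lambda>c. Poly_Mapping.map ((*) c))"
  by (simp_all add: chain_space_def)

lemma keys_scale: "Poly_Mapping.keys (Poly_Mapping.map ((*) (c::bit)) x) \<subseteq> Poly_Mapping.keys x"
  by (auto simp: in_keys_iff)

lemma scale_bit: "Poly_Mapping.map ((*) (c::bit)) x = (if c = 0 then 0 else x)"
  by (intro poly_mapping_eqI) (auto)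

lemma vectorspace_chain_space: "vectorspace class_ring (chain_space A)"
proof -
  have ag: "abelian_group (chain_space A)"
  proof (rule abelian_groupI, goal_cases)
    case (1 x y) then show ?case using keys_add[of x y] by auto
  next
    case (6 x)
    then show ?case by (intro bexI[of _ "-x"]) (auto simp: keys_def)
  qed (auto simp: ac_simps)
  have "module class_ring (chain_space A)"
  proof (rule moduleI, goal_cases)
    case 1 show ?case using class_cring.is_cring by simp
  next
    case 2 show ?case by (rule ag)
  qed (auto simp: scale_bit poly_mapping_eq_iff fun_eq_iff lookup_add algebra_simps)
  then show ?thesis
    by (simp add: vectorspace_def class_field.field_axioms)
qed

lemma vectorspace_quotient_space:
  assumes "vectorspace R V" and "VectorSpace.subspace R N V"
  shows "vectorspace R (quotient_space V N)"
proof -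
  interpret V: vectorspace R V by fact
  have sub: "submodule R N V" using assms(2) by (simp add: VectorSpace.subspace_def)
  have sg: "additive_subgroup N V"
  proof
    show "N \<subseteq> carrier (add_monoid V)" using submodule.subset[OF sub] by simp
    show "\<one>\<^bsub>add_monoid V\<^esub> \<in> N" using submodule.zero_closed[OF sub] by simp
    show "x \<otimes>\<^bsub>add_monoid V\<^esub> y \<in> N" if "x \<in> N" "y \<in> N" for x y
      using submodule.m_closed[OF sub] that by simp
    show "inv\<^bsub>add_monoid V\<^esub> x \<in> N" if "x \<in> N" for x
    proof -
      have xc: "x \<in> carrier V" using that submodule.subset[OF sub] by auto
      have "(\<ominus>\<^bsub>R\<^esub> \<one>\<^bsub>R\<^esub>) \<odot>\<^bsub>V\<^esub> x \<in> N" using submodule.smult_closed[OF sub] that by simp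
      then show ?thesis using V.smult_minus_1[OF xc] by (simp add: a_inv_def)
    qed
  qed
  interpret N: abelian_subgroup N V by (rule abelian_subgroupI3[OF sg V.abelian_group_axioms])
  let ?Q = "quotient_space V N"
  have ex: "\<exists>x\<in>carrier V. X = N +>\<^bsub>V\<^esub> x" if "X \<in> carrier ?Q" for X
    using that by (auto simp: quotient_space_def A_RCOSETS_def')
  have inQ: "N +>\<^bsub>V\<^esub> x \<in> carrier ?Q" if "x \<in> carrier V" for x
    using that by (auto simp: quotient_space_def A_RCOSETS_def')
  have smult: "c \<odot>\<^bsub>?Q\<^esub> (N +>\<^bsub>V\<^esub> x) = N +>\<^bsub>V\<^esub> (c \<odot>\<^bsub>V\<^esub> x)" if c: "c \<in> carrier R" and x: "x \<in> carrier V" for c x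
  proof -
    have "N +>\<^bsub>V\<^esub> (c \<odot>\<^bsub>V\<^esub> y) = N +>\<^bsub>V\<^esub> (c \<odot>\<^bsub>V\<^esub> x)" if y: "y \<in> N +>\<^bsub>V\<^esub> x" for y
    proof -
      obtain m where m: "m \<in> N" "y = m \<oplus>\<^bsub>V\<^esub> x" using y by (auto simp: a_r_coset_def')
      have mc: "m \<in> carrier V" using m N.a_subset by auto
      have "c \<odot>\<^bsub>V\<^esub> y = c \<odot>\<^bsub>V\<^esub> m \<oplus>\<^bsub>V\<^esub> c \<odot>\<^bsub>V\<^esub> x" using m mc c x by (simp add: V.smult_r_distr)
      moreover have "c \<odot>\<^bsub>V\<^esub> m \<in> N" using submodule.smult_closed[OF sub] c m by simp
      ultimately have "c \<odot>\<^bsub>V\<^esub> y \<in> N +>\<^bsub>V\<^esub> (c \<odot>\<^bsub>V\<^esub> x)" by (auto simp: a_r_coset_def')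
      then show ?thesis using N.a_repr_independence'[of "c \<odot>\<^bsub>V\<^esub> y" "c \<odot>\<^bsub>V\<^esub> x"] c x by auto
    qed
    moreover have "x \<in> N +>\<^bsub>V\<^esub> x" using N.a_rcos_self[OF x] .
    ultimately have "(\<Union>y\<in>N +>\<^bsub>V\<^esub> x. N +>\<^bsub>V\<^esub> (c \<odot>\<^bsub>V\<^esub> y)) = N +>\<^bsub>V\<^esub> (c \<odot>\<^bsub>V\<^esub> x)" by blast
    then show ?thesis by (simp add: quotient_space_def)
  qed
  have addQ: "(N +>\<^bsub>V\<^esub> x) \<oplus>\<^bsub>?Q\<^esub> (N +>\<^bsub>V\<^esub> y) = N +>\<^bsub>V\<^esub> (x \<oplus>\<^bsub>V\<^esub> y)" if "x \<in> carrier V" "y \<in> carrier V" for x y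
    using that by (simp add: quotient_space_def N.a_rcos_sum)
  have zeroQ: "\<zero>\<^bsub>?Q\<^esub> = N +>\<^bsub>V\<^esub> \<zero>\<^bsub>V\<^esub>"
    using N.a_subset by (auto simp: quotient_space_def a_r_coset_def' dest: subsetD)
  have agQ: "abelian_group ?Q"
  proof (rule abelian_groupI, goal_cases)
    case (6 X)
    then obtain x where x: "x \<in> carrier V" "X = N +>\<^bsub>V\<^esub> x" using ex by blast
    then show ?case
      by (intro bexI[of _ "N +>\<^bsub>V\<^esub> (\<ominus>\<^bsub>V\<^esub> x)"]) (simp_all add: addQ zeroQ inQ V.l_neg)
  qed (auto dest!: ex simp: addQ zeroQ V.a_ac intro!: inQ)
  have "module R ?Q"
  proof (rule moduleI, goal_cases)
    case 1 show ?case ..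
  next
    case 2 show ?case by (rule agQ)
  next
    case (3 c X) then show ?case by (auto dest!: ex simp: smult intro!: inQ)
  next
    case (4 a b X) then show ?case by (auto dest!: ex simp: smult addQ V.smult_l_distr)
  next
    case (5 a X Y) then show ?case by (auto dest!: ex simp: smult addQ V.smult_r_distr)
  next
    case (6 a b X) then show ?case by (auto dest!: ex simp: smult V.smult_assoc1)
  next
    case (7 X) then show ?case by (auto dest!: ex simp: smult)
  qed
  then show ?thesis by (simp add: vectorspace_def V.field_axioms)
qed

context cell_complex
begin

lemma chains_mono: "A \<subseteq> B \<Longrightarrow> chains A \<subseteq> chains B" by auto

lemma cells_subset: "cells K q \<subseteq> all_cells K" by (auto simp: all_cells_def)

lemma bd_add: "x \<in> chains (all_cells K) \<Longrightarrow> y \<in> chains (all_cells K) \<Longrightarrow> bd K (x + y) = bd K x + bd K y"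
proof -
  interpret linear_map class_ring "chain_space (all_cells K)" "chain_space (all_cells K)" "bd K"
    by (rule bd_linear)
  show "x \<in> chains (all_cells K) \<Longrightarrow> y \<in> chains (all_cells K) \<Longrightarrow> bd K (x + y) = bd K x + bd K y"
    using f_add[of x y] by simp
qed

lemma bd_zero [simp]: "bd K 0 = 0"
  using bd_add[of 0 0] by simp

lemma bd_closed: "x \<in> chains (all_cells K) \<Longrightarrow> bd K x \<in> chains (all_cells K)"
proof -
  interpret linear_map class_ring "chain_space (all_cells K)" "chain_space (all_cells K)" "bd K"
    by (rule bd_linear)
  show "x \<in> chains (all_cells K) \<Longrightarrow> bd K x \<in> chains (all_cells K)"
    using f_im[of x] by simp
qed

lemma submodule_bit:
  assumes "N \<subseteq> chains A" "0 \<in> N" "\<And>x y. x \<in> N \<Longrightarrow> y \<in> N \<Longrightarrow> x + y \<in> N"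
  shows "submodule class_ring N (chain_space A)"
  using assms vectorspace_chain_space[of A]
  by (auto simp: submodule_def vectorspace_def scale_bit)

lemma vectorspace_cycle_space: "vectorspace class_ring (cycle_space K q)"
proof -
  interpret V: vectorspace class_ring "chain_space (cells K q)" by (rule vectorspace_chain_space)
  have "submodule class_ring (cycles K q) (chain_space (cells K q))"
  proof (rule submodule_bit)
    fix x y assume xy: "x \<in> cycles K q" "y \<in> cycles K q"
    then have "bd K (x + y) = 0" using cells_subset[of q] bd_add[of x y] by (auto simp: cycles_def)
    then show "x + y \<in> cycles K q" using xy keys_add[of x y] by (auto simp: cycles_def)
  qed (auto simp: cycles_def)
  then have "VectorSpace.subspace class_ring (cycles K q) (chain_space (cells K q))"
    by (simp add: VectorSpace.subspace_def V.vectorspace_axioms)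
  then show ?thesis unfolding cycle_space_def by (rule V.subspace_is_vs)
qed

lemma boundaries_subset: "boundaries K q \<subseteq> cycles K q"
proof -
  have "bd K x \<in> cycles K q" if "x \<in> chains (cells K (Suc q))" for x
    using that bd_degree[OF that] bd_bd[of x] cells_subset[of "Suc q"] by (auto simp: cycles_def)
  then show ?thesis by (auto simp: boundaries_def)
qed

lemma subspace_boundaries: "VectorSpace.subspace class_ring (boundaries K q) (cycle_space K q)"
proof -
  have add: "x + y \<in> boundaries K q" if xy: "x \<in> boundaries K q" "y \<in> boundaries K q" for x y
  proof -
    obtain u v where uv: "x = bd K u" "y = bd K v" "u \<in> chains (cells K (Suc q))" "v \<in> chains (cells K (Suc q))"
      using xy by (auto simp: boundaries_def)
    then have "x + y = bd K (u + v)" using bd_add[of u v] cells_subset[of "Suc q"] by auto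
    moreover have "u + v \<in> chains (cells K (Suc q))" using uv keys_add[of u v] by auto
    ultimately show ?thesis by (auto simp: boundaries_def)
  qed
  have "0 \<in> boundaries K q" unfolding boundaries_def by (rule image_eqI[of _ _ 0]) auto
  then show ?thesis
    using boundaries_subset[of q] add vectorspace_cycle_space[of q]
    by (auto simp: VectorSpace.subspace_def submodule_def cycle_space_def vectorspace_def scale_bit)
qed

lemma vectorspace_homology: "vectorspace class_ring (homology K q)"
  unfolding homology_def
  by (rule vectorspace_quotient_space[OF vectorspace_cycle_space subspace_boundaries])

lemma bd_sum:
  assumes "finite I" "\<And>i. i \<in> I \<Longrightarrow> x i \<in> chains (all_cells K)"
  shows "bd K (\<Sum>i\<in>I. x i) = (\<Sum>i\<in>I. bd K (x i)) \<and> (\<Sum>i\<in>I. x i) \<in> chains (all_cells K)"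
  using assms
proof (induction I rule: finite_induct)
  case (insert i I)
  then show ?case using bd_add[of "x i" "sum x I"] keys_add[of "x i" "sum x I"] by auto
qed auto

lemma chain_eq_sum: "(x :: 'a chain) = (\<Sum>\<sigma>\<in>Poly_Mapping.keys x. cell_chain \<sigma>)"
proof (rule poly_mapping_eqI)
  fix \<tau>
  have "Poly_Mapping.lookup (\<Sum>\<sigma>\<in>Poly_Mapping.keys x. cell_chain \<sigma>) \<tau> =
      (\<Sum>\<sigma>\<in>Poly_Mapping.keys x. if \<sigma> = \<tau> then 1 else 0)"
    by (simp add: lookup_sum lookup_single when_def)
  then show "Poly_Mapping.lookup x \<tau> = Poly_Mapping.lookup (\<Sum>\<sigma>\<in>Poly_Mapping.keys x. cell_chain \<sigma>) \<tau>"
    by (simp add: in_keys_iff)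
qed

lemma is_subcomplex_iff:
  "is_subcomplex K B \<longleftrightarrow>
     B \<subseteq> all_cells K \<and> (\<forall>\<sigma>\<in>B. Poly_Mapping.keys (bd K (cell_chain \<sigma>)) \<subseteq> B)"
proof safe
  fix x assume "is_subcomplex K B" "x \<in> B" then show "x \<in> all_cells K" by (auto simp: is_subcomplex_def)
next
  fix \<sigma> \<tau> assume "is_subcomplex K B" "\<sigma> \<in> B" "\<tau> \<in> Poly_Mapping.keys (bd K (cell_chain \<sigma>))"
  then have "bd K (cell_chain \<sigma>) \<in> chains B"
    unfolding is_subcomplex_def image_subset_iff by simp
  then show "\<tau> \<in> B" using \<open>\<tau> \<in> _\<close> by auto
next
  assume B: "B \<subseteq> all_cells K" "\<forall>\<sigma>\<in>B. Poly_Mapping.keys (bd K (cell_chain \<sigma>)) \<subseteq> B"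
  have "bd K x \<in> chains B" if x: "x \<in> chains B" for x
  proof -
    have "bd K x = (\<Sum>\<sigma>\<in>Poly_Mapping.keys x. bd K (cell_chain \<sigma>))"
      using bd_sum[of "Poly_Mapping.keys x" cell_chain] x B by (auto simp flip: chain_eq_sum)
    then have "Poly_Mapping.keys (bd K x) \<subseteq> (\<Union>\<sigma>\<in>Poly_Mapping.keys x. Poly_Mapping.keys (bd K (cell_chain \<sigma>)))"
      using keys_sum[of "\<lambda>\<sigma>. bd K (cell_chain \<sigma>)" "Poly_Mapping.keys x"] by simp
    also have "\<dots> \<subseteq> B" using x B by (intro UN_least) auto
    finally show ?thesis by simp
  qed
  then show "is_subcomplex K B" using B unfolding is_subcomplex_def image_subset_iff by simp
qed

text \<open>The sub-complex generated by \<open>A\<close> consists of the cells of \<open>A\<close> and their iterated faces.\<close>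

lemma closure_cells_eq_faces:
  assumes "A \<subseteq> all_cells K"
  shows "closure_cells K A =
    {(\<sigma>, \<tau>). \<sigma> \<in> all_cells K \<and> \<tau> \<in> Poly_Mapping.keys (bd K (cell_chain \<sigma>))}\<^sup>* `` A" (is "_ = ?r\<^sup>* `` A")
proof
  have "is_subcomplex K (?r\<^sup>* `` A)"
    unfolding is_subcomplex_iff
  proof (intro conjI ballI subsetI)
    show *: "\<tau> \<in> all_cells K" if \<tau>: "\<tau> \<in> ?r\<^sup>* `` A" for \<tau>
    proof -
      from \<tau> obtain \<sigma> where "(\<sigma>, \<tau>) \<in> ?r\<^sup>*" "\<sigma> \<in> A" by blast
      then show ?thesis
      proof (induction rule: rtrancl_induct)
        case base then show ?case using assms by auto
      next
        case (step y z)
        then have "bd K (cell_chain y) \<in> chains (all_cells K)" by (intro bd_closed) auto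
        then show ?case using step by auto
      qed
    qed
    fix \<tau> \<rho> assume "\<tau> \<in> ?r\<^sup>* `` A" "\<rho> \<in> Poly_Mapping.keys (bd K (cell_chain \<tau>))"
    moreover from this(1) have "\<tau> \<in> all_cells K" by (rule *)
    ultimately obtain \<sigma> where "\<sigma> \<in> A" "(\<sigma>, \<tau>) \<in> ?r\<^sup>*" "(\<tau>, \<rho>) \<in> ?r" by blast
    then show "\<rho> \<in> ?r\<^sup>* `` A" by (meson ImageI rtrancl_into_rtrancl)
  qed
  moreover have "A \<subseteq> ?r\<^sup>* `` A" by blast
  ultimately show "closure_cells K A \<subseteq> ?r\<^sup>* `` A" unfolding closure_cells_def by (intro Inter_lower) simp
next
  show "?r\<^sup>* `` A \<subseteq> closure_cells K A"
    unfolding closure_cells_def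
  proof safe
    fix \<sigma> \<tau> B assume B: "A \<subseteq> B" "is_subcomplex K B" and "(\<sigma>, \<tau>) \<in> ?r\<^sup>*" "\<sigma> \<in> A"
    from this(3,4) show "\<tau> \<in> B"
      by (induction rule: rtrancl_induct) (use B in \<open>auto simp: is_subcomplex_iff\<close>)
  qed
qed

lemma subcomplex_closure_cells:
  assumes "A \<subseteq> all_cells K"
  shows "is_subcomplex K (closure_cells K A)" and "A \<subseteq> closure_cells K A"
proof -
  have top: "is_subcomplex K (all_cells K)" using bd_closed by (auto simp: is_subcomplex_def)
  have "closure_cells K A \<subseteq> all_cells K" using top assms unfolding closure_cells_def by blast
  moreover have "Poly_Mapping.keys (bd K (cell_chain \<sigma>)) \<subseteq> closure_cells K A"
    if "\<sigma> \<in> closure_cells K A" for \<sigma>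
    using that unfolding closure_cells_def is_subcomplex_iff by blast
  ultimately show "is_subcomplex K (closure_cells K A)" unfolding is_subcomplex_iff by blast
  show "A \<subseteq> closure_cells K A" by (auto simp: closure_cells_def)
qed

lemma all_cells_generated_subcomplex:
  assumes "A \<subseteq> all_cells K"
  shows "all_cells (generated_subcomplex K A) = closure_cells K A"
  using subcomplex_closure_cells[OF assms]
  by (auto simp: generated_subcomplex_def all_cells_def is_subcomplex_def)

lemma cell_complex_generated_subcomplex:
  assumes A: "A \<subseteq> all_cells K"
  shows "cell_complex n (generated_subcomplex K A)"
proof -
  let ?B = "closure_cells K A"
  have sub: "?B \<subseteq> all_cells K" "bd K ` chains ?B \<subseteq> chains ?B"
    using subcomplex_closure_cells(1)[OF A] by (auto simp: is_subcomplex_def)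
  have B: "x \<in> chains ?B \<Longrightarrow> bd K x \<in> chains ?B" for x using sub(2) by blast
  have lin: "linear_map class_ring (chain_space ?B) (chain_space ?B) (bd K)"
  proof -
    have "bd K \<in> LinearCombinations.module_hom class_ring (chain_space ?B) (chain_space ?B)"
      using B sub(1) by (auto simp: LinearCombinations.module_hom_def scale_bit intro!: bd_add)
    then have "mod_hom class_ring (chain_space ?B) (chain_space ?B) (bd K)"
      using vectorspace_chain_space[of ?B]
      by (simp add: mod_hom_def mod_hom_axioms_def vectorspace_def del: chain_space_simps)
    then show ?thesis
      using vectorspace_chain_space[of ?B] by (intro linear_map.intro)
  qed
  show ?thesis
  proof (rule cell_complex.intro, goal_cases)
    case (5 q x)
    then have "bd K x \<in> chains (cells K q)" "bd K x \<in> chains ?B"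
      using bd_degree[of x q] B[of x] by (auto simp: generated_subcomplex_def)
    then show ?case by (auto simp: generated_subcomplex_def)
  next
    case 4 show ?case unfolding all_cells_generated_subcomplex[OF A] using lin
      by (simp add: generated_subcomplex_def)
  next
    case (6 x) then show ?case using bd_0[of x] by (auto simp: generated_subcomplex_def)
  next
    case (7 x) then show ?case using bd_bd[of x] sub(1) unfolding all_cells_generated_subcomplex[OF A]
      by (auto simp: generated_subcomplex_def)
  qed (use finite_cells disjoint_cells cells_above in \<open>auto simp: generated_subcomplex_def\<close>)
qed

end

end

theory Submission
  imports Defs
begin

text \<open>
  Over the field with two elements, \<open>g\<close> sends a chain \<open>c\<close> of critical cells to \<open>c + H(\<partial>\<^sub>C\<^sub>P c)\<close>,
  the unique chain in \<open>c + Span S\<close> whose boundary has no \<open>P\<close>-component. Every chain is a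
  sum \<open>\<partial>s + g(c) + s'\<close> with \<open>s\<close> and \<open>s'\<close> in \<open>Span S\<close>. If \<open>d = 0\<close>, then \<open>\<partial>g(c) = 0\<close>, so the
  boundary of this sum is \<open>\<partial>s'\<close>, and it vanishes only for \<open>s' = 0\<close>. Hence a cycle is \<open>\<partial>s + g(c)\<close>,
  a boundary without \<open>P\<close>-component is zero, and the cycles \<open>g(\<gamma>)\<close> form a homology basis.

  The cells of the cycles \<open>g(\<gamma>)\<close> lie in \<open>C \<union> S\<close>, and \<open>\<gamma>\<close> is the only cell of \<open>C\<close> in \<open>g(\<gamma>)\<close>.
  In the sub-complex that they generate there are no \<open>(q+1)\<close>-cells and no \<open>q\<close>-cells of \<open>P\<close>, so
  there \<open>s = 0\<close> in the decomposition of a \<open>q\<close>-cycle, and the same family is a basis of its homology.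
\<close>

section \<open>Chains and coordinate projections\<close>

lemma chain_add_self [simp]: "(x :: 'a chain) + x = 0"
proof (rule poly_mapping_eqI)
  fix k
  have "b + b = 0" for b :: bit by (cases b) auto
  then show "Poly_Mapping.lookup (x + x) k = Poly_Mapping.lookup 0 k" by (simp add: lookup_add)
qed

text \<open>Declared simp together with \<open>chain_diff\<close>, this erases the signs in
  \<open>hdvf_G\<close> and \<open>reduced_bd\<close>, so that only sums of chains remain.\<close>

lemma chain_uminus [simp]: "- (x :: 'a chain) = x"
  by (metis chain_add_self minus_unique)

lemma chain_diff [simp]: "(x :: 'a chain) - y = x + y"
  by (metis chain_uminus diff_conv_add_uminus)

lemma chain_add_self_left [simp]: "(x :: 'a chain) + (x + y) = y"
  by (simp flip: add.assoc)

lemma chain_add_eq_0_iff: "(x :: 'a chain) + y = 0 \<longleftrightarrow> x = y"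
  by (metis chain_uminus eq_neg_iff_add_eq_0)

lemma keys_proj: "Poly_Mapping.keys (proj A x) = Poly_Mapping.keys x \<inter> A"
  by (auto simp: in_keys_iff lookup_proj simp del: bit_not_zero_iff)

lemma proj_add: "proj A (x + y) = proj A x + proj A y"
  by (rule poly_mapping_eqI) (simp add: lookup_proj lookup_add when_add_distrib)

lemma proj_ident: "Poly_Mapping.keys x \<subseteq> A \<Longrightarrow> proj A x = x"
  by (rule poly_mapping_eqI) (auto simp: lookup_proj when_def in_keys_iff)

lemma proj_eq_0: "Poly_Mapping.keys x \<inter> A = {} \<Longrightarrow> proj A x = 0"
  by (rule poly_mapping_eqI) (auto simp: lookup_proj when_def in_keys_iff)

lemma proj_0 [simp]: "proj A 0 = 0"
  by (simp add: proj_eq_0)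

lemma proj_eq_0D: "proj A x = 0 \<Longrightarrow> Poly_Mapping.keys x \<inter> A = {}"
  by (metis keys_proj keys_zero)

lemma proj_add_compl: "proj A x + proj (- A) x = x"
  by (rule poly_mapping_eqI) (auto simp: lookup_proj lookup_add when_def)

lemma keys_addI:
  "Poly_Mapping.keys x \<subseteq> A \<Longrightarrow> Poly_Mapping.keys y \<subseteq> A \<Longrightarrow> Poly_Mapping.keys (x + y) \<subseteq> A"
  using keys_add[of x y] by blast

text \<open>With coefficients in a two-element field, a chain carries the same information as its
  finite set of cells. This translates subset sums into chains and back.\<close>

lemma keys_sum_cell_chain:
  assumes "finite T"
  shows "Poly_Mapping.keys (\<Sum>\<sigma>\<in>T. cell_chain \<sigma>) = T"
proof -
  have "Poly_Mapping.lookup (\<Sum>\<sigma>\<in>T. cell_chain \<sigma>) \<tau> = (if \<tau> \<in> T then 1 else 0)" for \<tau>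
    using assms by (simp add: lookup_sum lookup_single when_def)
  then show ?thesis by (auto simp: in_keys_iff split: if_splits)
qed


section \<open>Homology bases by subset sums\<close>

context cell_complex
begin

lemma boundaries_zero [simp]: "0 \<in> boundaries K q"
  unfolding boundaries_def by (rule image_eqI[of _ _ 0]) auto

lemma boundaries_add: "x \<in> boundaries K q \<Longrightarrow> y \<in> boundaries K q \<Longrightarrow> x + y \<in> boundaries K q"
  using subspace_boundaries[of q] submodule.m_closed
  by (fastforce simp: VectorSpace.subspace_def cycle_space_def)

lemma homology_class_eq: "homology_class K q z = (\<lambda>b. b + z) ` boundaries K q"
  by (auto simp: homology_class_def a_r_coset_def' cycle_space_def)

text \<open>Two cosets agree when their representatives differ by a boundary; in characteristic two
  that difference is the sum.\<close>

lemma homology_class_eq_iff: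
  "homology_class K q x = homology_class K q y \<longleftrightarrow> x + y \<in> boundaries K q"
proof
  assume "homology_class K q x = homology_class K q y"
  moreover have "x \<in> homology_class K q x"
    unfolding homology_class_eq by (rule image_eqI[of _ _ 0]) auto
  ultimately obtain b where "b \<in> boundaries K q" "x = b + y"
    unfolding homology_class_eq by auto
  then show "x + y \<in> boundaries K q" by (simp add: add.assoc)
next
  assume xy: "x + y \<in> boundaries K q"
  have sub: "homology_class K q u \<subseteq> homology_class K q v" if "u + v \<in> boundaries K q" for u v
  proof
    fix w assume "w \<in> homology_class K q u"
    then obtain b where b: "b \<in> boundaries K q" "w = b + u" by (auto simp: homology_class_eq)
    then have "w = (b + (u + v)) + v" by (simp add: add.assoc)
    then show "w \<in> homology_class K q v"
      using boundaries_add[OF b(1) that] by (auto simp: homology_class_eq)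
  qed
  show "homology_class K q x = homology_class K q y"
    using sub[of x y] sub[of y x] xy by (auto simp: add.commute)
qed

lemma carrier_homology: "carrier (homology K q) = homology_class K q ` cycles K q"
  by (auto simp: homology_def quotient_space_def A_RCOSETS_def' homology_class_def cycle_space_def)

lemma zero_homology: "\<zero>\<^bsub>homology K q\<^esub> = homology_class K q 0"
  by (simp add: homology_class_eq) (simp add: homology_def quotient_space_def)

lemma homology_class_add:
  "homology_class K q x \<oplus>\<^bsub>homology K q\<^esub> homology_class K q y = homology_class K q (x + y)"
proof -
  have "homology_class K q x \<oplus>\<^bsub>homology K q\<^esub> homology_class K q y =
      {u + v | u v. u \<in> homology_class K q x \<and> v \<in> homology_class K q y}"
    by (auto simp: homology_def quotient_space_def set_add_def' cycle_space_def)
  also have "\<dots> = homology_class K q (x + y)"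
  proof safe
    fix u v assume "u \<in> homology_class K q x" "v \<in> homology_class K q y"
    then obtain b c where "b \<in> boundaries K q" "c \<in> boundaries K q" "u = b + x" "v = c + y"
      by (auto simp: homology_class_eq)
    then show "u + v \<in> homology_class K q (x + y)"
      using boundaries_add[of b q c] unfolding homology_class_eq
      by (intro image_eqI[of _ _ "b + c"]) (auto simp: ac_simps)
  next
    fix w assume "w \<in> homology_class K q (x + y)"
    then obtain b where b: "b \<in> boundaries K q" "w = b + (x + y)" by (auto simp: homology_class_eq)
    have "b + x \<in> homology_class K q x" "y \<in> homology_class K q y"
      using b(1) by (auto simp: homology_class_eq intro: image_eqI[of _ _ 0])
    then show "\<exists>u v. w = u + v \<and> u \<in> homology_class K q x \<and> v \<in> homology_class K q y"
      using b(2) by (metis add.assoc)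
  qed
  finally show ?thesis .
qed

text \<open>A coefficient is 0 or 1, so a linear combination only selects the indices with
  coefficient 1. This moves computations from the quotient space to chains.\<close>

lemma finsum_homology_class:
  fixes a :: "'i \<Rightarrow> bit"
  assumes "finite I" "\<And>i. i \<in> I \<Longrightarrow> z i \<in> cycles K q"
  shows "(\<Oplus>\<^bsub>homology K q\<^esub>i\<in>I. a i \<odot>\<^bsub>homology K q\<^esub> homology_class K q (z i)) =
    homology_class K q (sum z {i \<in> I. a i = 1})"
proof -
  interpret V: vectorspace class_ring "homology K q" by (rule vectorspace_homology)
  have scale: "c \<odot>\<^bsub>homology K q\<^esub> homology_class K q x =
      (if c = 1 then homology_class K q x else homology_class K q 0)"
    if "x \<in> cycles K q" for c :: bit and x
  proof -
    have "homology_class K q x \<in> carrier (homology K q)" using that by (simp add: carrier_homology)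
    then show ?thesis using V.smult_one V.smult_l_null
      by (cases c) (auto simp: zero_homology)
  qed
  show ?thesis
    using assms
  proof (induction I rule: finite_induct)
    case empty
    then show ?case by (simp add: zero_homology)
  next
    case (insert j I)
    have mem: "homology_class K q (z i) \<in> carrier (homology K q)" if "i \<in> insert j I" for i
      using insert.prems that by (simp add: carrier_homology)
    have "(\<Oplus>\<^bsub>homology K q\<^esub>i\<in>insert j I. a i \<odot>\<^bsub>homology K q\<^esub> homology_class K q (z i)) =
        a j \<odot>\<^bsub>homology K q\<^esub> homology_class K q (z j) \<oplus>\<^bsub>homology K q\<^esub>
        homology_class K q (sum z {i \<in> I. a i = 1})"
      using insert mem by (subst V.finsum_insert) auto
    also have "\<dots> = homology_class K q (sum z {i \<in> insert j I. a i = 1})"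
    proof (cases "a j = 1")
      case True
      then have "{i \<in> insert j I. a i = 1} = insert j {i \<in> I. a i = 1}" by auto
      then show ?thesis using insert True by (simp add: scale homology_class_add)
    next
      case False
      then have "{i \<in> insert j I. a i = 1} = {i \<in> I. a i = 1}" by auto
      then show ?thesis using insert False by (simp add: scale homology_class_add)
    qed
    finally show ?case .
  qed
qed

text \<open>Over two elements, linear combinations of the family are its subset sums. Independence
  and generation can therefore be tested on chains modulo boundaries; injectivity is the case of
  two-element subsets.\<close>

lemma homology_basisI:
  assumes fin: "finite I" and cyc: "\<And>i. i \<in> I \<Longrightarrow> z i \<in> cycles K q"
    and indep: "\<And>T. T \<subseteq> I \<Longrightarrow> sum z T \<in> boundaries K q \<Longrightarrow> T = {}"
    and gen: "\<And>x. x \<in> cycles K q \<Longrightarrow> \<exists>T\<subseteq>I. x + sum z T \<in> boundaries K q"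
  shows "homology_basis K q I z"
proof -
  interpret V: vectorspace class_ring "homology K q" by (rule vectorspace_homology)
  let ?c = "\<lambda>i. homology_class K q (z i)"
  have inj: "inj_on ?c I"
  proof (rule inj_onI, rule ccontr)
    fix i j assume "i \<in> I" "j \<in> I" "?c i = ?c j" "i \<noteq> j"
    then show False using indep[of "{i, j}"] by (simp add: homology_class_eq_iff)
  qed
  have car: "?c ` I \<subseteq> carrier (homology K q)" using cyc by (auto simp: carrier_homology)
  have lincomb: "V.lincomb a (?c ` I) = homology_class K q (sum z {i \<in> I. a (?c i) = 1})"
    for a :: "'a chain set \<Rightarrow> bit"
  proof -
    have "V.lincomb a (?c ` I) = (\<Oplus>\<^bsub>homology K q\<^esub>i\<in>I. a (?c i) \<odot>\<^bsub>homology K q\<^esub> ?c i)"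
      unfolding V.lincomb_def
      using inj car by (subst V.finsum_reindex) (auto intro!: V.smult_closed)
    then show ?thesis using finsum_homology_class[OF fin cyc] by simp
  qed
  have "\<not> V.lin_dep (?c ` I)"
  proof (rule V.finite_lin_indpt2)
    fix a :: "'a chain set \<Rightarrow> bit"
    assume "V.lincomb a (?c ` I) = \<zero>\<^bsub>homology K q\<^esub>"
    then have "sum z {i \<in> I. a (?c i) = 1} \<in> boundaries K q"
      by (simp add: lincomb zero_homology homology_class_eq_iff)
    then have "{i \<in> I. a (?c i) = 1} = {}" by (intro indep) auto
    then show "\<forall>v\<in>?c ` I. a v = \<zero>\<^bsub>class_ring\<^esub>" by (auto simp: bit_not_one_iff)
  qed (use fin car in auto)
  moreover have "V.gen_set (?c ` I)"
  proof
    show "V.span (?c ` I) \<subseteq> carrier (homology K q)" using car by (rule V.span_is_subset2)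
    show "carrier (homology K q) \<subseteq> V.span (?c ` I)"
    proof
      fix X assume "X \<in> carrier (homology K q)"
      then obtain x where x: "x \<in> cycles K q" "X = homology_class K q x"
        by (auto simp: carrier_homology)
      then obtain T where T: "T \<subseteq> I" "x + sum z T \<in> boundaries K q" using gen by blast
      \<comment> \<open>Coefficients are attached to classes, not to indices; injectivity of the
        family recovers \<open>T\<close> from them.\<close>
      let ?a = "\<lambda>v. if v \<in> ?c ` T then 1 else (0::bit)"
      have "{i \<in> I. ?a (?c i) = 1} = T" using T(1) inj by (auto dest: inj_onD)
      then have "X = V.lincomb ?a (?c ` I)"
        using x T by (simp add: lincomb homology_class_eq_iff)
      then show "X \<in> V.span (?c ` I)" using V.finite_span[OF _ car] fin by auto
    qed
  qed
  ultimately show ?thesis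
    using fin cyc inj car unfolding homology_basis_def V.basis_def by auto
qed

lemma homology_basis_dim:
  assumes "homology_basis K q I z"
  shows "vectorspace.dim class_ring (homology K q) = card I"
proof -
  interpret V: vectorspace class_ring "homology K q" by (rule vectorspace_homology)
  show ?thesis
    using assms V.dim_basis[of "(\<lambda>i. homology_class K q (z i)) ` I"]
    by (simp add: homology_basis_def card_image)
qed

end


section \<open>The decomposition of chains induced by an HDVF\<close>

locale hdvf_complex = cell_complex n K for n :: nat and K :: "'a complex_data" +
  fixes P S C :: "'a set"
  assumes hdvf: "hdvf K P S C"
begin

abbreviation H :: "'a chain \<Rightarrow> 'a chain" where
  "H \<equiv> hdvf_H K P S"

text \<open>The map \<open>g\<close> of the associated reduction, with the sign dropped in characteristic two.\<close>

definition lift :: "'a chain \<Rightarrow> 'a chain" where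
  "lift c = c + H (proj P (bd K c))"

lemma parts: "P \<union> S \<union> C = all_cells K" "P \<inter> S = {}" "P \<inter> C = {}" "S \<inter> C = {}"
  using hdvf by (auto simp: hdvf_def)

section \<open>The inverse of the block of the boundary from S to P\<close>

lemma H_closed: "Poly_Mapping.keys y \<subseteq> P \<Longrightarrow> Poly_Mapping.keys (H y) \<subseteq> S"
  and proj_bd_H: "Poly_Mapping.keys y \<subseteq> P \<Longrightarrow> proj P (bd K (H y)) = y"
proof -
  have bij: "bij_betw (bd_part K S P) (chains S) (chains P)" using hdvf by (simp add: hdvf_def)
  assume y: "Poly_Mapping.keys y \<subseteq> P"
  then have H: "H y = the_inv_into (chains S) (bd_part K S P) y" by (simp add: hdvf_H_def)
  have "the_inv_into (chains S) (bd_part K S P) y \<in> chains S"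
    using bij y by (intro the_inv_into_into) (auto simp: bij_betw_def)
  then show "Poly_Mapping.keys (H y) \<subseteq> S" using H by simp
  moreover have "bd_part K S P (H y) = y"
    unfolding H using bij y by (intro f_the_inv_into_f_bij_betw[of _ "chains S" "chains P"]) auto
  ultimately show "proj P (bd K (H y)) = y" by (simp add: bd_part_def)
qed

text \<open>Injectivity of the S-to-P block, in the form by which the later arguments show that a
  chain on \<open>S\<close> vanishes.\<close>

lemma eq_0_if_proj_bd_eq_0:
  assumes "Poly_Mapping.keys s \<subseteq> S" "proj P (bd K s) = 0"
  shows "s = 0"
proof -
  have "inj_on (bd_part K S P) (chains S)" using hdvf by (simp add: hdvf_def bij_betw_def)
  moreover have "bd_part K S P s = bd_part K S P 0" using assms by (simp add: bd_part_def)
  ultimately show ?thesis using assms(1) by (auto dest: inj_onD)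
qed

lemma bd_add_keys:
  "Poly_Mapping.keys x \<subseteq> all_cells K \<Longrightarrow> Poly_Mapping.keys y \<subseteq> all_cells K \<Longrightarrow>
    bd K (x + y) = bd K x + bd K y"
  using bd_add by simp

lemma H_unique:
  assumes "Poly_Mapping.keys y \<subseteq> P" "Poly_Mapping.keys s \<subseteq> S" "proj P (bd K s) = y"
  shows "H y = s"
proof -
  have Hy: "Poly_Mapping.keys (H y) \<subseteq> S" using assms(1) by (rule H_closed)
  have "proj P (bd K (H y + s)) = 0"
    using Hy assms parts(1) by (subst bd_add_keys) (auto simp: proj_add proj_bd_H)
  then have "H y + s = 0" using Hy assms(2) eq_0_if_proj_bd_eq_0 keys_addI by blast
  then show ?thesis by (simp add: chain_add_eq_0_iff)
qed

lemma H_0 [simp]: "H 0 = 0"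
  by (rule H_unique) auto

text \<open>\<open>hdvf\<close> records invertibility as a bijection. Additivity of the inverse
  comes from uniqueness: \<open>H x + H y\<close> solves the equation that defines
  \<open>H (x + y)\<close>.\<close>

lemma H_add:
  assumes "Poly_Mapping.keys x \<subseteq> P" "Poly_Mapping.keys y \<subseteq> P"
  shows "H (x + y) = H x + H y"
proof (rule H_unique)
  have S: "Poly_Mapping.keys (H x) \<subseteq> S" "Poly_Mapping.keys (H y) \<subseteq> S"
    using assms by (auto dest: H_closed)
  then show "Poly_Mapping.keys (H x + H y) \<subseteq> S" by (rule keys_addI)
  show "proj P (bd K (H x + H y)) = x + y"
    using S assms parts(1) by (subst bd_add_keys) (auto simp: proj_add proj_bd_H)
qed (use assms in \<open>rule keys_addI\<close>)

section \<open>The inverse raises the degree by one\<close>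

lemma bd_off_degree:
  assumes "Poly_Mapping.keys x \<subseteq> all_cells K - cells K (Suc q)"
  shows "Poly_Mapping.keys (bd K x) \<inter> cells K q = {}"
proof -
  have "bd K x = (\<Sum>\<sigma>\<in>Poly_Mapping.keys x. bd K (cell_chain \<sigma>))"
    using bd_sum[of "Poly_Mapping.keys x" cell_chain] assms by (auto simp flip: chain_eq_sum)
  then have "Poly_Mapping.keys (bd K x) \<subseteq>
      (\<Union>\<sigma>\<in>Poly_Mapping.keys x. Poly_Mapping.keys (bd K (cell_chain \<sigma>)))"
    using keys_sum[of "\<lambda>\<sigma>. bd K (cell_chain \<sigma>)" "Poly_Mapping.keys x"] by simp
  moreover have "Poly_Mapping.keys (bd K (cell_chain \<sigma>)) \<inter> cells K q = {}"
    if "\<sigma> \<in> Poly_Mapping.keys x" for \<sigma>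
  proof -
    have "\<sigma> \<in> all_cells K" "\<sigma> \<notin> cells K (Suc q)" using assms that by auto
    then obtain p where p: "\<sigma> \<in> cells K p" "p \<noteq> Suc q"
      unfolding all_cells_def by blast
    show ?thesis
    proof (cases p)
      case 0
      then show ?thesis using bd_0[of "cell_chain \<sigma>"] p by simp
    next
      case (Suc r)
      then have "Poly_Mapping.keys (bd K (cell_chain \<sigma>)) \<subseteq> cells K r"
        using bd_degree[of "cell_chain \<sigma>" r] p by simp
      then show ?thesis using disjoint_cells[of r q] p Suc by auto
    qed
  qed
  ultimately show ?thesis by blast
qed

text \<open>The block is inverted in all degrees at once, so homogeneity needs an argument. Let
  \<open>r\<close> be the part of \<open>H y\<close> outside degree \<open>Suc q\<close>. The
  P-component of its boundary consists of q-cells, being the sum of \<open>y\<close> and a component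
  of the boundary of a (q+1)-chain. But \<open>r\<close> has no (q+1)-cells, so that component
  contains no q-cell either. It is zero, hence so is \<open>r\<close>.\<close>

lemma H_degree:
  assumes "Poly_Mapping.keys y \<subseteq> P \<inter> cells K q"
  shows "Poly_Mapping.keys (H y) \<subseteq> cells K (Suc q)"
proof -
  define s where "s = H y"
  define a r where "a = proj (cells K (Suc q)) s" and "r = proj (- cells K (Suc q)) s"
  have s: "Poly_Mapping.keys s \<subseteq> S" "proj P (bd K s) = y" "s = a + r"
    using assms by (auto simp: s_def a_def r_def H_closed proj_bd_H proj_add_compl)
  have ar: "Poly_Mapping.keys a \<subseteq> all_cells K" "Poly_Mapping.keys a \<subseteq> cells K (Suc q)"
      "Poly_Mapping.keys r \<subseteq> all_cells K - cells K (Suc q)" "Poly_Mapping.keys r \<subseteq> S"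
    using s(1) parts(1) by (auto simp: a_def r_def keys_proj)
  have "y = proj P (bd K a) + proj P (bd K r)"
    unfolding s(2)[symmetric] s(3) using ar by (subst bd_add_keys) (auto simp: proj_add)
  then have r_eq: "proj P (bd K r) = proj P (bd K a) + y" by simp
  have "Poly_Mapping.keys (bd K a) \<subseteq> cells K q" using bd_degree[of a q] ar by simp
  then have "Poly_Mapping.keys (proj P (bd K r)) \<subseteq> cells K q"
    unfolding r_eq using assms by (intro keys_addI) (auto simp: keys_proj)
  moreover have "Poly_Mapping.keys (proj P (bd K r)) \<inter> cells K q = {}"
    using bd_off_degree[OF ar(3)] by (auto simp: keys_proj)
  ultimately have "proj P (bd K r) = 0" by (metis inf.absorb1 keys_eq_empty)
  then have "r = 0" using ar(4) eq_0_if_proj_bd_eq_0 by blast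
  then show ?thesis using s(3) ar(2) by (simp add: s_def)
qed

section \<open>Lifting chains of critical cells\<close>

lemma keys_proj_P: "Poly_Mapping.keys (proj P x) \<subseteq> P"
  by (simp add: keys_proj)

text \<open>In characteristic two the sum \<open>c + lift c\<close> is just the correction added by
  \<open>lift\<close>, a value of \<open>H\<close>.\<close>

lemma lift_keys: "Poly_Mapping.keys (c + lift c) \<subseteq> S"
  using H_closed[OF keys_proj_P] by (simp add: lift_def)

lemma lift_degree:
  assumes "Poly_Mapping.keys c \<subseteq> cells K q"
  shows "Poly_Mapping.keys (lift c) \<subseteq> cells K q"
proof (cases q)
  \<comment> \<open>The correction vanishes in degree 0 because the boundary does; in positive
    degree \<open>H\<close> makes up for the degree lost by the boundary.\<close>
  case 0
  then show ?thesis using assms bd_0[of c] by (simp add: lift_def)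
next
  case (Suc r)
  have "Poly_Mapping.keys (bd K c) \<subseteq> cells K r" using bd_degree[of c r] assms Suc by simp
  then have "Poly_Mapping.keys (proj P (bd K c)) \<subseteq> P \<inter> cells K r" by (auto simp: keys_proj)
  from H_degree[OF this] show ?thesis unfolding lift_def using assms Suc by (intro keys_addI) auto
qed

lemma lift_keys_all:
  assumes "Poly_Mapping.keys c \<subseteq> all_cells K"
  shows "Poly_Mapping.keys (lift c) \<subseteq> all_cells K"
  unfolding lift_def using assms H_closed[OF keys_proj_P] parts(1) by (intro keys_addI) auto

text \<open>The correction is chosen for this: the P-component of its boundary is that of
  \<open>bd K c\<close>, and the two cancel.\<close>

lemma proj_bd_lift:
  assumes "Poly_Mapping.keys c \<subseteq> all_cells K"
  shows "proj P (bd K (lift c)) = 0"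
  unfolding lift_def using assms H_closed[OF keys_proj_P, of "bd K c"] parts(1)
  by (subst bd_add_keys) (auto simp: proj_add proj_bd_H keys_proj_P)

lemma lift_0 [simp]: "lift 0 = 0"
  by (simp add: lift_def)

lemma lift_add:
  assumes "Poly_Mapping.keys c \<subseteq> all_cells K" "Poly_Mapping.keys d \<subseteq> all_cells K"
  shows "lift (c + d) = lift c + lift d"
  using assms by (simp add: lift_def bd_add_keys proj_add H_add keys_proj_P ac_simps)

lemma lift_sum:
  assumes "finite T" "T \<subseteq> all_cells K"
  shows "lift (\<Sum>\<gamma>\<in>T. cell_chain \<gamma>) = (\<Sum>\<gamma>\<in>T. lift (cell_chain \<gamma>))"
  using assms
proof (induction T rule: finite_induct)
  case (insert \<gamma> T)
  then show ?case by (simp add: lift_add keys_sum_cell_chain)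
qed simp

lemma proj_S_eq_0I: "Poly_Mapping.keys x \<subseteq> S \<Longrightarrow> proj C x = 0"
  using parts by (intro proj_eq_0) auto

text \<open>The correction lies on \<open>S\<close>, which \<open>C\<close> misses. Thus
  \<open>lift\<close> is injective on chains of critical cells, and the lift of a critical cell
  contains no other critical cell.\<close>

lemma proj_C_lift:
  assumes "Poly_Mapping.keys c \<subseteq> C"
  shows "proj C (lift c) = c"
proof -
  have "proj C (c + lift c) = 0" using lift_keys by (rule proj_S_eq_0I)
  then show ?thesis using assms by (simp add: proj_add proj_ident chain_add_eq_0_iff)
qed

text \<open>Without a P-component, \<open>x\<close> differs from its C-component by a chain on
  \<open>S\<close>, and so does the lift of that component.\<close>

lemma lift_proj_C:
  assumes x: "Poly_Mapping.keys x \<subseteq> all_cells K" and P: "proj P x = 0"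
  shows "Poly_Mapping.keys (x + lift (proj C x)) \<subseteq> S"
proof -
  have "x + lift (proj C x) = (x + proj C x) + (proj C x + lift (proj C x))"
    by (simp add: ac_simps)
  moreover have "x + proj C x = proj (- C) x"
    using proj_add_compl[of C x] by (metis add.commute chain_add_self_left)
  moreover have "Poly_Mapping.keys (proj (- C) x) \<subseteq> S"
    using x proj_eq_0D[OF P] parts by (auto simp: keys_proj)
  ultimately show ?thesis using lift_keys[of "proj C x"] by (simp only: keys_addI)
qed

end


section \<open>Perfect HDVFs\<close>

locale perfect_hdvf_complex = hdvf_complex +
  assumes perfect: "perfect_hdvf K P S C"
begin

text \<open>The C-component of this boundary is the reduced boundary of \<open>c\<close>, zero by
  perfection, and the P-component is cancelled by the correction. What is left lies on
  \<open>S\<close> and is a cycle, so injectivity of the S-to-P block kills it.\<close>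

lemma bd_lift:
  assumes c: "Poly_Mapping.keys c \<subseteq> C"
  shows "bd K (lift c) = 0"
proof (rule eq_0_if_proj_bd_eq_0)
  have c': "Poly_Mapping.keys c \<subseteq> all_cells K" using c parts by auto
  let ?s = "H (proj P (bd K c))"
  have s: "Poly_Mapping.keys ?s \<subseteq> S" by (rule H_closed[OF keys_proj_P])
  have "reduced_bd K P S C c = 0" using perfect c by (simp add: perfect_hdvf_def)
  then have "proj C (bd K c) + proj C (bd K ?s) = 0"
    using c s by (simp add: reduced_bd_def bd_part_def)
  then have "proj C (bd K (lift c)) = 0"
    unfolding lift_def using c' s parts(1) by (subst bd_add_keys) (auto simp: proj_add)
  moreover have "Poly_Mapping.keys (bd K (lift c)) \<subseteq> all_cells K"
    using bd_closed[of "lift c"] lift_keys_all[OF c'] by simp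
  ultimately show "Poly_Mapping.keys (bd K (lift c)) \<subseteq> S"
    using parts(1) proj_eq_0D proj_bd_lift[OF c'] by blast
  show "proj P (bd K (bd K (lift c))) = 0"
    using bd_bd[of "lift c"] lift_keys_all[OF c'] by simp
qed

text \<open>The difference of the two sides lies on \<open>S\<close>, and its boundary is that of
  \<open>x\<close> because lifts are cycles. Asking only for a vanishing P-component of
  \<open>bd K x\<close> makes this usable in \<open>boundary_eq_0\<close>.\<close>

lemma cycle_eq_lift:
  assumes x: "Poly_Mapping.keys x \<subseteq> all_cells K" and P: "proj P x = 0" and bd: "proj P (bd K x) = 0"
  shows "x = lift (proj C x)"
proof -
  have C: "Poly_Mapping.keys (proj C x) \<subseteq> C" by (simp add: keys_proj)
  then have "Poly_Mapping.keys (proj C x) \<subseteq> all_cells K" using parts by auto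
  then have "bd K (x + lift (proj C x)) = bd K x"
    using x C by (simp add: bd_add_keys lift_keys_all bd_lift)
  then have "x + lift (proj C x) = 0"
    using lift_proj_C[OF x P] bd eq_0_if_proj_bd_eq_0 by simp
  then show ?thesis by (simp add: chain_add_eq_0_iff)
qed

text \<open>Adding the boundary of \<open>H (proj P x)\<close> clears the P-component of
  \<open>x\<close> while changing neither its boundary nor, for a cycle, its homology class.\<close>

lemma
  assumes x: "Poly_Mapping.keys x \<subseteq> all_cells K"
  shows proj_P_reduce: "proj P (x + bd K (H (proj P x))) = 0"
    and keys_reduce: "Poly_Mapping.keys (x + bd K (H (proj P x))) \<subseteq> all_cells K"
    and bd_reduce: "bd K (x + bd K (H (proj P x))) = bd K x"
proof -
  have H: "Poly_Mapping.keys (H (proj P x)) \<subseteq> all_cells K"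
    using H_closed[OF keys_proj_P] parts(1) by auto
  then have bdH: "Poly_Mapping.keys (bd K (H (proj P x))) \<subseteq> all_cells K"
    using bd_closed[of "H (proj P x)"] by simp
  show "proj P (x + bd K (H (proj P x))) = 0" by (simp add: proj_add proj_bd_H keys_proj_P)
  show "Poly_Mapping.keys (x + bd K (H (proj P x))) \<subseteq> all_cells K" using x bdH by (rule keys_addI)
  show "bd K (x + bd K (H (proj P x))) = bd K x"
    using x bdH H bd_bd[of "H (proj P x)"] by (simp add: bd_add_keys)
qed

text \<open>Clearing the P-component of \<open>w\<close> keeps its boundary and yields a lift, which
  is a cycle.\<close>

lemma boundary_eq_0:
  assumes w: "Poly_Mapping.keys w \<subseteq> all_cells K" and P: "proj P (bd K w) = 0"
  shows "bd K w = 0"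
proof -
  let ?u = "w + bd K (H (proj P w))"
  have "?u = lift (proj C ?u)"
    using proj_P_reduce[OF w] keys_reduce[OF w] bd_reduce[OF w] P by (intro cycle_eq_lift) simp_all
  then have "bd K ?u = 0" using bd_lift[of "proj C ?u"] by (simp add: keys_proj)
  then show ?thesis using bd_reduce[OF w] by simp
qed

text \<open>The sum is the lift of a chain on \<open>C\<close>, so it has no P-component. Being a
  boundary it is then zero, and projecting to \<open>C\<close> recovers the chain.\<close>

lemma lift_independent:
  assumes T: "T \<subseteq> C" and fin: "finite T" and bnd: "(\<Sum>\<gamma>\<in>T. lift (cell_chain \<gamma>)) \<in> boundaries K q"
  shows "T = {}"
proof -
  let ?c = "\<Sum>\<gamma>\<in>T. cell_chain \<gamma>"
  have c: "Poly_Mapping.keys ?c \<subseteq> C" using fin T by (simp add: keys_sum_cell_chain)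
  have T': "T \<subseteq> all_cells K" using T parts by auto
  from bnd obtain w where w: "Poly_Mapping.keys w \<subseteq> cells K (Suc q)" "lift ?c = bd K w"
    using fin T' by (auto simp: boundaries_def lift_sum)
  have "proj P (lift ?c) = proj P ?c + proj P (?c + lift ?c)" by (simp flip: proj_add)
  also have "\<dots> = 0" using c lift_keys[of ?c] parts by (subst (1 2) proj_eq_0) auto
  finally have "bd K w = 0"
    using w cells_subset[of "Suc q"] by (intro boundary_eq_0) auto
  then have "?c = 0" using proj_C_lift[OF c] w by simp
  then show ?thesis using keys_sum_cell_chain[OF fin] by simp
qed

lemma lift_eq_sum:
  assumes "Poly_Mapping.keys c \<subseteq> all_cells K"
  shows "lift c = (\<Sum>\<gamma>\<in>Poly_Mapping.keys c. lift (cell_chain \<gamma>))"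
  using lift_sum[of "Poly_Mapping.keys c"] assms by (simp flip: chain_eq_sum)

lemma lift_cycle: "\<gamma> \<in> C \<inter> cells K q \<Longrightarrow> lift (cell_chain \<gamma>) \<in> cycles K q"
  using lift_degree[of "cell_chain \<gamma>" q] bd_lift[of "cell_chain \<gamma>"] by (simp add: cycles_def)

lemma lift_homology_basis:
  "homology_basis K q (C \<inter> cells K q) (\<lambda>\<gamma>. lift (cell_chain \<gamma>))"
proof (rule homology_basisI)
  show "finite (C \<inter> cells K q)" using finite_cells by simp
  show "T = {}"
    if "T \<subseteq> C \<inter> cells K q" "(\<Sum>\<gamma>\<in>T. lift (cell_chain \<gamma>)) \<in> boundaries K q" for T
    using that finite_cells by (intro lift_independent[OF _ _ that(2)]) (auto intro: finite_subset)
next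
  fix x assume x: "x \<in> cycles K q"
  \<comment> \<open>\<open>?u\<close> is the homologous cycle without P-component; the critical
    cells in it index the required subset sum, and \<open>?s\<close> bounds the difference.\<close>
  let ?s = "H (proj P x)" let ?u = "x + bd K ?s"
  have xk: "Poly_Mapping.keys x \<subseteq> cells K q" "Poly_Mapping.keys x \<subseteq> all_cells K" "bd K x = 0"
    using x cells_subset[of q] by (auto simp: cycles_def)
  have s: "Poly_Mapping.keys ?s \<subseteq> cells K (Suc q)" using xk by (intro H_degree) (auto simp: keys_proj)
  then have "Poly_Mapping.keys ?u \<subseteq> cells K q"
    using xk bd_degree[of ?s q] by (intro keys_addI) auto
  then have T: "Poly_Mapping.keys (proj C ?u) \<subseteq> C \<inter> cells K q" by (auto simp: keys_proj)
  have "?u = lift (proj C ?u)"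
    using proj_P_reduce keys_reduce bd_reduce xk by (intro cycle_eq_lift) simp_all
  also have "\<dots> = (\<Sum>\<gamma>\<in>Poly_Mapping.keys (proj C ?u). lift (cell_chain \<gamma>))"
    using T parts by (intro lift_eq_sum) auto
  finally have "x + (\<Sum>\<gamma>\<in>Poly_Mapping.keys (proj C ?u). lift (cell_chain \<gamma>)) = bd K ?s"
    by (metis chain_add_self_left)
  moreover have "bd K ?s \<in> boundaries K q" using s by (auto simp: boundaries_def)
  ultimately show "\<exists>T\<subseteq>C \<inter> cells K q. x + (\<Sum>\<gamma>\<in>T. lift (cell_chain \<gamma>)) \<in> boundaries K q"
    using T by (intro exI[of _ "Poly_Mapping.keys (proj C ?u)"]) simp
qed (rule lift_cycle)

end

section \<open>Homology of the sub-complex generated by the lifted cycles\<close>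

lemma (in cell_complex) closure_cells_degree:
  assumes A: "A \<subseteq> cells K q"
  shows "closure_cells K A \<subseteq> A \<union> (\<Union>p<q. cells K p)"
proof -
  \<comment> \<open>Faces have lower dimension, so adding all cells below dimension q already gives
    a sub-complex, and the closure is contained in it.\<close>
  let ?B = "A \<union> (\<Union>p<q. cells K p)"
  have "is_subcomplex K ?B"
    unfolding is_subcomplex_iff
  proof (intro conjI ballI)
    show "?B \<subseteq> all_cells K" using A by (auto simp: all_cells_def)
    fix \<sigma> assume "\<sigma> \<in> ?B"
    then obtain p where p: "p \<le> q" "\<sigma> \<in> cells K p" using A by (fastforce dest: less_imp_le)
    show "Poly_Mapping.keys (bd K (cell_chain \<sigma>)) \<subseteq> ?B"
    proof (cases p)
      case 0
      then show ?thesis using p bd_0[of "cell_chain \<sigma>"] by simp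
    next
      case (Suc r)
      then show ?thesis using p bd_degree[of "cell_chain \<sigma>" r] by auto
    qed
  qed
  then show ?thesis unfolding closure_cells_def by (intro Inter_lower) simp
qed

text \<open>Independence is inherited, since boundaries of the sub-complex are boundaries in
  \<open>K\<close>. For generation, the q-cells of the sub-complex are exactly \<open>A\<close> and
  avoid \<open>P\<close>, so each of its q-cycles equals a sum of lifts, with no boundary to
  add.\<close>

lemma (in perfect_hdvf_complex) lift_homology_basis_generated:
  fixes q
  defines "A \<equiv> \<Union>\<gamma>\<in>C \<inter> cells K q. Poly_Mapping.keys (lift (cell_chain \<gamma>))"
  shows "cell_complex n (generated_subcomplex K A)"
    and "homology_basis (generated_subcomplex K A) q (C \<inter> cells K q) (\<lambda>\<gamma>. lift (cell_chain \<gamma>))"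
proof -
  let ?L = "generated_subcomplex K A"
  have Aq: "A \<subseteq> cells K q"
    unfolding A_def using lift_degree[of "cell_chain _" q] by (intro UN_least) simp
  have A: "A \<subseteq> all_cells K" using Aq cells_subset[of q] by blast
  have "Poly_Mapping.keys (lift (cell_chain \<gamma>)) \<inter> P = {}" if "\<gamma> \<in> C" for \<gamma>
  proof -
    have "Poly_Mapping.keys (cell_chain \<gamma> + (cell_chain \<gamma> + lift (cell_chain \<gamma>))) \<subseteq> C \<union> S"
      using lift_keys[of "cell_chain \<gamma>"] that by - (rule keys_addI, auto)
    then show ?thesis using parts by (simp only: chain_add_self_left) blast
  qed
  then have AP: "A \<inter> P = {}" unfolding A_def by blast
  have clo: "A \<subseteq> closure_cells K A" "closure_cells K A \<subseteq> A \<union> (\<Union>p<q. cells K p)"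
    using subcomplex_closure_cells(2)[OF A] closure_cells_degree[OF Aq] .
  have "cells K q \<inter> (\<Union>p<q. cells K p) = {}" by (auto simp: Int_UN_distrib disjoint_cells)
  then have "cells K q \<inter> closure_cells K A = A" using clo Aq by blast
  then have cells_q: "cells ?L q = A" by (simp add: generated_subcomplex_def)
  have bd: "bd ?L = bd K" by (simp add: generated_subcomplex_def)
  have bnd: "boundaries ?L q \<subseteq> boundaries K q"
    by (auto simp: boundaries_def bd) (auto simp: generated_subcomplex_def)
  show "cell_complex n ?L" using A by (rule cell_complex_generated_subcomplex)
  then interpret L: cell_complex n ?L .
  show "homology_basis ?L q (C \<inter> cells K q) (\<lambda>\<gamma>. lift (cell_chain \<gamma>))"
  proof (rule L.homology_basisI)
    show "finite (C \<inter> cells K q)" using finite_cells by simp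
    show "lift (cell_chain \<gamma>) \<in> cycles ?L q" if "\<gamma> \<in> C \<inter> cells K q" for \<gamma>
    proof -
      have "Poly_Mapping.keys (lift (cell_chain \<gamma>)) \<subseteq> A" unfolding A_def using that by blast
      then show ?thesis using lift_cycle[OF that] by (simp add: cycles_def cells_q bd)
    qed
    show "T = {}"
      if "T \<subseteq> C \<inter> cells K q" "(\<Sum>\<gamma>\<in>T. lift (cell_chain \<gamma>)) \<in> boundaries ?L q" for T
      using that finite_cells bnd by (intro lift_independent[of T q]) (auto intro: finite_subset)
  next
    fix x assume "x \<in> cycles ?L q"
    then have x: "Poly_Mapping.keys x \<subseteq> A" "bd K x = 0" by (auto simp: cycles_def cells_q bd)
    then have "x = lift (proj C x)" using A AP by (intro cycle_eq_lift proj_eq_0) auto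
    also have "\<dots> = (\<Sum>\<gamma>\<in>Poly_Mapping.keys (proj C x). lift (cell_chain \<gamma>))"
      using parts by (intro lift_eq_sum) (auto simp: keys_proj)
    finally have "x + (\<Sum>\<gamma>\<in>Poly_Mapping.keys (proj C x). lift (cell_chain \<gamma>)) = 0"
      by (simp add: chain_add_eq_0_iff)
    moreover have "Poly_Mapping.keys (proj C x) \<subseteq> C \<inter> cells K q"
      using x(1) Aq by (auto simp: keys_proj)
    ultimately show "\<exists>T\<subseteq>C \<inter> cells K q. x + (\<Sum>\<gamma>\<in>T. lift (cell_chain \<gamma>)) \<in> boundaries ?L q"
      using L.boundaries_zero by metis
  qed
qed

section \<open>Explicitness of the basis\<close>

lemma (in perfect_hdvf_complex) lift_explicit_homology_basis:
  "explicit_homology_basis K q (C \<inter> cells K q) (\<lambda>\<gamma>. lift (cell_chain \<gamma>))"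
  unfolding explicit_homology_basis_def
proof (intro conjI ballI)
  show "homology_basis K q (C \<inter> cells K q) (\<lambda>\<gamma>. lift (cell_chain \<gamma>))"
    by (rule lift_homology_basis)
  show "vectorspace.dim class_ring (homology (generated_subcomplex K
      (\<Union>\<gamma>\<in>C \<inter> cells K q. Poly_Mapping.keys (lift (cell_chain \<gamma>)))) q) = card (C \<inter> cells K q)"
    \<comment> \<open>The two conclusions of \<open>lift_homology_basis_generated\<close> discharge,
      in order, the locale premise and the basis premise.\<close>
    by (rule cell_complex.homology_basis_dim[OF lift_homology_basis_generated])
next
  fix \<gamma> assume \<gamma>: "\<gamma> \<in> C \<inter> cells K q"
  have keys_C: "Poly_Mapping.keys (lift (cell_chain \<delta>)) \<inter> C = {\<delta>}" if "\<delta> \<in> C" for \<delta>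
    using arg_cong[OF proj_C_lift[of "cell_chain \<delta>"], of Poly_Mapping.keys] that
    by (simp add: keys_proj)
  \<comment> \<open>The private cell of the cycle attached to a critical cell is that critical cell
    itself.\<close>
  have "\<gamma> \<in> Poly_Mapping.keys (lift (cell_chain \<gamma>))" using keys_C[of \<gamma>] \<gamma> by blast
  moreover have "\<gamma> \<notin> Poly_Mapping.keys (lift (cell_chain \<delta>))" if "\<delta> \<in> C" "\<delta> \<noteq> \<gamma>" for \<delta>
    using keys_C[OF that(1)] that(2) \<gamma> by auto
  ultimately show "Poly_Mapping.keys (lift (cell_chain \<gamma>)) -
      (\<Union>\<delta>\<in>C \<inter> cells K q - {\<gamma>}. Poly_Mapping.keys (lift (cell_chain \<delta>))) \<noteq> {}"
    by blast
qed

text \<open>The map \<open>g\<close> is specified only on chains of \<open>C\<close>, so the two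
  families are compared on the index set alone. Unions over both \<open>I\<close> and
  \<open>I - {k}\<close> occur, hence the auxiliary fact for every subset \<open>J\<close>.\<close>

lemma explicit_homology_basis_cong:
  assumes "\<And>i. i \<in> I \<Longrightarrow> z i = z' i"
  shows "explicit_homology_basis K q I z \<longleftrightarrow> explicit_homology_basis K q I z'"
proof -
  have "(\<Union>i\<in>J. Poly_Mapping.keys (z i)) = (\<Union>i\<in>J. Poly_Mapping.keys (z' i))" if "J \<subseteq> I" for J
    using assms that by (intro SUP_cong) auto
  moreover have "inj_on (\<lambda>i. homology_class K q (z i)) I \<longleftrightarrow> inj_on (\<lambda>i. homology_class K q (z' i)) I"
    "(\<lambda>i. homology_class K q (z i)) ` I = (\<lambda>i. homology_class K q (z' i)) ` I" "z ` I = z' ` I"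
    using assms by (auto intro!: inj_on_cong image_cong)
  ultimately show ?thesis
    using assms by (simp add: explicit_homology_basis_def homology_basis_def)
qed

theorem theorem1:
  fixes K :: "'a complex_data" and n :: nat and P S C :: "'a set"
    and f g h :: "'a chain \<Rightarrow> 'a chain" and q :: nat
  assumes "cell_complex n K"
    and "perfect_hdvf K P S C"
    and "hdvf_reduction K P S C = (f, g, h)"
  shows "explicit_homology_basis K q (C \<inter> cells K q) (\<lambda>\<gamma>. g (cell_chain \<gamma>))"
proof -
  interpret cell_complex n K by fact
  interpret perfect_hdvf_complex n K P S C
    using assms(2) by unfold_locales (auto simp: perfect_hdvf_def)
  have "g (cell_chain \<gamma>) = lift (cell_chain \<gamma>)" if "\<gamma> \<in> C \<inter> cells K q" for \<gamma>
  proof -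
    have "g = (\<lambda>x\<in>chains C. x + hdvf_G K P S C x)"
      using assms(3) by (simp add: hdvf_reduction_def)
    then show ?thesis using that by (simp add: hdvf_G_def bd_part_def lift_def)
  qed
  then show ?thesis
    using lift_explicit_homology_basis explicit_homology_basis_cong by (metis (no_types, lifting))
qed

end
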